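(* Let $f$ be a conformal e-predictor on a non-empty measurable space $\mathbf{Z}$, let $Z_1,Z_2,\dots$ be an exchangeable infinite sequence of $\mathbf{Z}$-valued random elements, and let $e_n:=f(Z_1,\dots,Z_n)$, $n=1,2,\dots$, be the conformal e-values. Let $c>1$ and define the alarm times of the conformal reverse Shiryaev--Roberts e-procedure by $\tau_0:=0$ and \[ \tau_k:=\min\Bigl\{n>\tau_{k-1}:\ \max_{i\in\{\tau_{k-1}+1,\dots,n\}}\ \sum_{j=i}^n e_i\cdots e_j\ge c\Bigr\},\qquad k=1,2,\dots. \] Let $A_n:=\max\{k\mid\tau_k\le n\}$ be the number of alarms raised after processing the first $n$ observations. Then \[ \limsup_{n\to\infty}\frac{A_n}{n}\le\frac1c\quad\text{a.s.} \]
   Context: For a set $X$, $X^+:=\bigcup_{n=1}^\infty X^n$ is the set of non-empty finite sequences of elements of $X$ (a measurable space if $X$ is). A nonconformity e-measure is a measurable function $A:\mathbf{Z}^+\to[0,\infty)^+$ mapping every finite sequence $(z_1,\dots,z_m)$, $m\ge1$, to a sequence $(\alpha_1,\dots,\alpha_m)$ of the same length such that (i) $\frac1m\sum_{i=1}^m\alpha_i\le1$, and (ii) (equivariance) for any $m$ and any permutation $\pi$ of $\{1,\dots,m\}$, if $(\alpha_1,\dots,\alpha_m)=A(z_1,\dots,z_m)$ then $(\alpha_{\pi(1)},\dots,\alpha_{\pi(m)})=A(z_{\pi(1)},\dots,z_{\pi(m)})$. The corresponding conformal e-predictor is $f:\mathbf{Z}^+\to[0,\infty)$, $f(z_1,\dots,z_m):=\alpha_m$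 where $(\alpha_1,\dots,\alpha_m)=A(z_1,\dots,z_m)$. An infinite sequence of random elements is exchangeable if the joint distribution of each finite initial segment is invariant under permutations. Conventions: $n$ ranges over positive integers; $\min\emptyset:=\infty$ (so if $\tau_{k-1}=\infty$ then $\tau_k=\infty$); in the definition of $A_n$, $k$ ranges over $\{0,1,2,\dots\}$. *)

theory Defs
  imports "HOL-Probability.Probability" "HOL-Combinatorics.Permutations"
begin

text \<open>
  The measurable space \<open>X\<^sup>+\<close> of non-empty finite sequences is the disjoint union of the
  product spaces \<open>X\<^sup>n\<close>, \<open>n \<ge> 1\<close>: a set of lists is measurable iff, for every \<open>n \<ge> 1\<close>, the lists
  of length \<open>n\<close> in it form a measurable subset of \<open>X\<^sup>n\<close> (see \<open>sets_nonempty_seqs\<close>).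
\<close>

definition nonempty_seqs :: "'a measure \<Rightarrow> 'a list measure" where
  "nonempty_seqs X = sigma {xs. xs \<noteq> [] \<and> set xs \<subseteq> space X}
     {B. B \<subseteq> {xs. xs \<noteq> [] \<and> set xs \<subseteq> space X} \<and>
         (\<forall>n\<ge>1. (\<lambda>x. map x [0..<n]) -` B \<inter> space (\<Pi>\<^sub>M i\<in>{..<n}. X) \<in> sets (\<Pi>\<^sub>M i\<in>{..<n}. X))}"

lemma space_nonempty_seqs: "space (nonempty_seqs X) = {xs. xs \<noteq> [] \<and> set xs \<subseteq> space X}"
  unfolding nonempty_seqs_def by (rule space_measure_of) auto

lemma map_upt_in_nonempty_seqs:
  assumes "x \<in> space (\<Pi>\<^sub>M i\<in>{..<n}. X)" "n \<ge> 1"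
  shows "map x [0..<n] \<in> {xs. xs \<noteq> [] \<and> set xs \<subseteq> space X}"
  using assms by (auto simp: space_PiM PiE_def Pi_def)

lemma sets_nonempty_seqs:
  "sets (nonempty_seqs X) =
     {B. B \<subseteq> {xs. xs \<noteq> [] \<and> set xs \<subseteq> space X} \<and>
         (\<forall>n\<ge>1. (\<lambda>x. map x [0..<n]) -` B \<inter> space (\<Pi>\<^sub>M i\<in>{..<n}. X) \<in> sets (\<Pi>\<^sub>M i\<in>{..<n}. X))}"
    (is "_ = ?S")
proof -
  let ?O = "{xs. xs \<noteq> [] \<and> set xs \<subseteq> space X}"
  have "sigma_algebra ?O ?S"
    unfolding sigma_algebra_iff2
  proof (intro conjI ballI allI impI)
    show "?S \<subseteq> Pow ?O" "{} \<in> ?S" by auto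
  next
    fix B assume B: "B \<in> ?S"
    have "(\<lambda>x. map x [0..<n]) -` (?O - B) \<inter> space (\<Pi>\<^sub>M i\<in>{..<n}. X) \<in> sets (\<Pi>\<^sub>M i\<in>{..<n}. X)"
      if n: "n \<ge> 1" for n
    proof -
      have "(\<lambda>x. map x [0..<n]) -` (?O - B) \<inter> space (\<Pi>\<^sub>M i\<in>{..<n}. X)
        = space (\<Pi>\<^sub>M i\<in>{..<n}. X) - ((\<lambda>x. map x [0..<n]) -` B \<inter> space (\<Pi>\<^sub>M i\<in>{..<n}. X))"
        using map_upt_in_nonempty_seqs[OF _ n, of _ X] by blast
      then show ?thesis using B n by auto
    qed
    then show "?O - B \<in> ?S" by auto
  next
    fix B :: "nat \<Rightarrow> 'a list set" assume B: "range B \<subseteq> ?S"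
    have "(\<lambda>x. map x [0..<n]) -` (\<Union>i. B i) \<inter> space (\<Pi>\<^sub>M i\<in>{..<n}. X) \<in> sets (\<Pi>\<^sub>M i\<in>{..<n}. X)"
      if n: "n \<ge> 1" for n
    proof -
      have "(\<lambda>x. map x [0..<n]) -` (\<Union>i. B i) \<inter> space (\<Pi>\<^sub>M i\<in>{..<n}. X)
        = (\<Union>i. (\<lambda>x. map x [0..<n]) -` B i \<inter> space (\<Pi>\<^sub>M i\<in>{..<n}. X))" by blast
      also have "\<dots> \<in> sets (\<Pi>\<^sub>M i\<in>{..<n}. X)"
        using B n by (intro sets.countable_UN) auto
      finally show ?thesis .
    qed
    then show "(\<Union>i. B i) \<in> ?S" using B by auto
  qed
  then show ?thesis
    unfolding nonempty_seqs_def
    by (subst sets_measure_of) (auto simp: sigma_algebra.sigma_sets_eq)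
qed

text \<open>
  Lists are indexed from \<open>0\<close>, so permutations of the positions are permutations of
  \<open>{..<m}\<close>; \<open>permute_list \<pi> zs\<close> has \<open>zs ! \<pi> i\<close> in position \<open>i\<close>.
\<close>

definition nonconformity_e_measure :: "'z measure \<Rightarrow> ('z list \<Rightarrow> real list) \<Rightarrow> bool" where
  "nonconformity_e_measure N A \<longleftrightarrow>
     A \<in> nonempty_seqs N \<rightarrow>\<^sub>M nonempty_seqs (restrict_space borel {0..}) \<and>
     (\<forall>zs\<in>space (nonempty_seqs N).
        length (A zs) = length zs \<and>
        (1 / real (length zs)) * (\<Sum>i<length zs. A zs ! i) \<le> 1 \<and>
        (\<forall>\<pi>. \<pi> permutes {..<length zs} \<longrightarrow>
             A (permute_list \<pi> zs) = permute_list \<pi> (A zs)))"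

definition conformal_e_predictor :: "'z measure \<Rightarrow> ('z list \<Rightarrow> real) \<Rightarrow> bool" where
  "conformal_e_predictor N f \<longleftrightarrow>
     (\<exists>A. nonconformity_e_measure N A \<and> (\<forall>zs\<in>space (nonempty_seqs N). f zs = last (A zs)))"

text \<open>Sequences of random elements and of e-values are indexed from \<open>1\<close>; index \<open>0\<close> is ignored.\<close>

definition exchangeable :: "'w measure \<Rightarrow> 'z measure \<Rightarrow> (nat \<Rightarrow> 'w \<Rightarrow> 'z) \<Rightarrow> bool" where
  "exchangeable M N Z \<longleftrightarrow>
     (\<forall>n\<ge>1. Z n \<in> M \<rightarrow>\<^sub>M N) \<and>
     (\<forall>n\<ge>1. \<forall>\<pi>. \<pi> permutes {1..n} \<longrightarrow>
        distr M (\<Pi>\<^sub>M i\<in>{1..n}. N) (\<lambda>\<omega>. \<lambda>i\<in>{1..n}. Z (\<pi> i) \<omega>)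
      = distr M (\<Pi>\<^sub>M i\<in>{1..n}. N) (\<lambda>\<omega>. \<lambda>i\<in>{1..n}. Z i \<omega>))"

definition conformal_e_value ::
    "('z list \<Rightarrow> real) \<Rightarrow> (nat \<Rightarrow> 'w \<Rightarrow> 'z) \<Rightarrow> 'w \<Rightarrow> nat \<Rightarrow> real" where
  "conformal_e_value f Z \<omega> n = f (map (\<lambda>i. Z i \<omega>) [1..<Suc n])"

text \<open>
  In \<open>enat\<close> the infimum of a non-empty set is its minimum and the infimum of the empty set is
  \<open>\<infinity>\<close>.  The index set \<open>{i. \<tau> < enat i \<and> i \<le> n}\<close> is \<open>{\<tau> + 1, \<dots>, n}\<close>, which is non-empty whenever
  \<open>\<tau> < enat n\<close>.
\<close>

fun alarm_time :: "real \<Rightarrow> (nat \<Rightarrow> real) \<Rightarrow> nat \<Rightarrow> enat" where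
  "alarm_time c e 0 = 0"
| "alarm_time c e (Suc k) =
     Inf (enat ` {n. alarm_time c e k < enat n \<and>
            Max ((\<lambda>i. \<Sum>j=i..n. \<Prod>l=i..j. e l) ` {i. alarm_time c e k < enat i \<and> i \<le> n}) \<ge> c})"

text \<open>The set below is finite (\<open>finite_alarms\<close>) and contains \<open>0\<close>, so that \<open>Max\<close> is meaningful.\<close>

definition num_alarms :: "real \<Rightarrow> (nat \<Rightarrow> real) \<Rightarrow> nat \<Rightarrow> nat" where
  "num_alarms c e n = Max {k. alarm_time c e k \<le> enat n}"

lemma alarm_time_ge: "enat k \<le> alarm_time c e k"
proof (induction k)
  case 0
  then show ?case by (simp add: zero_enat_def)
next
  case (Suc k)
  have "enat (Suc k) \<le> enat n" if "alarm_time c e k < enat n" for n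
    using order.strict_trans1[OF Suc that] by simp
  then show ?case
    unfolding alarm_time.simps by (intro Inf_greatest) blast
qed

lemma finite_alarms: "finite {k. alarm_time c e k \<le> enat n}"
proof (rule finite_subset)
  show "{k. alarm_time c e k \<le> enat n} \<subseteq> {..n}"
  proof
    fix k assume "k \<in> {k. alarm_time c e k \<le> enat n}"
    then have "enat k \<le> enat n"
      using alarm_time_ge[of k c e] by (metis mem_Collect_eq order_trans)
    then show "k \<in> {..n}" by simp
  qed
qed simp

end

theory Submission
  imports Defs
begin

text \<open>
  Conformal e-values behave well backwards in time: by equivariance \<open>e\<^sub>i\<^sub>+\<^sub>1, \<dots>, e\<^sub>n\<close> do not
  change when \<open>Z\<^sub>1, \<dots>, Z\<^sub>i\<close> are permuted, so by exchangeability
  \<open>E (e\<^sub>i h) \<le> E h\<close> for every bounded \<open>h \<ge> 0\<close> that is a function of \<open>e\<^sub>i\<^sub>+\<^sub>1, \<dots>, e\<^sub>n\<close>.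
  Run the recursion \<open>R \<leftarrow> e\<^sub>i (1 + R)\<close> from \<open>i = n\<close> down to \<open>i = 1\<close>, raising an alarm and resetting
  \<open>R\<close> to \<open>0\<close> whenever it reaches \<open>c\<close>. Each interval \<open>{\<tau>\<^sub>k\<^sub>-\<^sub>1 + 1, \<dots>, \<tau>\<^sub>k}\<close> contains one of
  these backward alarms, so it suffices to bound their number. In each backward step the quantity
  \<open>c \<cdot> (number of alarms) + R - (number of steps)\<close> has an increment that is bounded by \<open>c + 1\<close> and
  has non-positive conditional mean. An Azuma-type exponential bound then makes the
  probability of at least \<open>(1 + \<epsilon>) n / c\<close> alarms geometrically small in \<open>n\<close>, and the
  Borel--Cantelli lemma concludes.
\<close>

section \<open>The Shiryaev--Roberts recursion\<close>

text \<open>The lists below stand for \<open>e\<^sub>i, \<dots>, e\<^sub>n\<close> and are consumed from the right, that is, backwards in time.\<close>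

fun reverse_sum :: "real list \<Rightarrow> real" where
  "reverse_sum [] = 0"
| "reverse_sum (x # xs) = x * (1 + reverse_sum xs)"

text \<open>For \<open>c \<ge> 0\<close> the reset keeps the state at most \<open>c\<close>. This
  cap is what makes the increments of the backward process bounded.\<close>

fun reverse_sr :: "real \<Rightarrow> real list \<Rightarrow> real" where
  "reverse_sr c [] = 0"
| "reverse_sr c (x # xs) =
     (if c \<le> x * (1 + reverse_sr c xs) then 0 else x * (1 + reverse_sr c xs))"

fun reverse_alarms :: "real \<Rightarrow> real list \<Rightarrow> nat" where
  "reverse_alarms c [] = 0"
| "reverse_alarms c (x # xs) =
     reverse_alarms c xs + (if c \<le> x * (1 + reverse_sr c xs) then 1 else 0)"

section \<open>Comparison of forward and backward alarms\<close>

text \<open>Horner's scheme: \<open>e i\<close> is a common factor of all products starting at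
  \<open>i\<close>, and the term \<open>j = i\<close> supplies the \<open>1\<close>.\<close>

lemma reverse_sum_map_upt:
  assumes "i \<le> n"
  shows "reverse_sum (map e [i..<Suc n]) = (\<Sum>j=i..n. \<Prod>l=i..j. e l)"
  using assms
proof (induction i rule: inc_induct)
  case base
  then show ?case by simp
next
  case (step i)
  have "(\<Sum>j=i..n. \<Prod>l=i..j. e l) = e i + (\<Sum>j=Suc i..n. \<Prod>l=i..j. e l)"
    using step by (simp add: sum.atLeast_Suc_atMost)
  also have "(\<Sum>j=Suc i..n. \<Prod>l=i..j. e l) = (\<Sum>j=Suc i..n. e i * (\<Prod>l=Suc i..j. e l))"
    by (intro sum.cong refl) (simp add: prod.atLeast_Suc_atMost)
  finally have *: "(\<Sum>j=i..n. \<Prod>l=i..j. e l) = e i * (1 + (\<Sum>j=Suc i..n. \<Prod>l=Suc i..j. e l))"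
    by (simp add: sum_distrib_left algebra_simps)
  have "[i..<Suc n] = i # [Suc i..<Suc n]"
    using step by (simp add: upt_conv_Cons)
  then show ?case using step.IH * by simp
qed

lemma reverse_sr_nonneg:
  assumes "\<forall>x\<in>set xs. 0 \<le> x"
  shows "0 \<le> reverse_sr c xs"
  using assms by (induction xs) auto

lemma reverse_sr_le:
  assumes "0 \<le> c"
  shows "reverse_sr c xs \<le> c"
  using assms by (cases xs) auto

lemma reverse_alarms_le_length: "reverse_alarms c xs \<le> length xs"
  by (induction xs) auto

text \<open>Turns the recursive counter into the cardinality of a set of positions, into which
  forward alarms can then be mapped injectively.\<close>

lemma reverse_alarms_map_upt:
  assumes "i \<le> Suc n"
  shows "reverse_alarms c (map e [i..<Suc n])
    = card {j\<in>{i..n}. c \<le> e j * (1 + reverse_sr c (map e [Suc j..<Suc n]))}"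
  using assms
proof (induction i rule: inc_induct)
  case base
  then show ?case by simp
next
  case (step i)
  let ?P = "\<lambda>j. c \<le> e j * (1 + reverse_sr c (map e [Suc j..<Suc n]))"
  have upt: "[i..<Suc n] = i # [Suc i..<Suc n]"
    using step by (simp add: upt_conv_Cons)
  have "{j\<in>{i..n}. ?P j} = (if ?P i then {i} else {}) \<union> {j\<in>{Suc i..n}. ?P j}"
    using step by (auto simp: not_less_eq_eq[symmetric] dest: antisym)
  then have "card {j\<in>{i..n}. ?P j} = (if ?P i then 1 else 0) + card {j\<in>{Suc i..n}. ?P j}"
    by (auto simp: card_insert_if)
  then show ?case using step.IH upt by simp
qed

text \<open>Without a reset both sides follow the same monotone recursion. They differ only in their
  start at \<open>Suc m\<close>: the left side starts from \<open>0\<close>, the right side from the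
  non-negative state left by the entries after \<open>m\<close>.\<close>

lemma reverse_sr_ge_reverse_sum:
  assumes nn: "\<And>j. i \<le> j \<Longrightarrow> j \<le> n \<Longrightarrow> 0 \<le> e j" and "i \<le> Suc m" "m \<le> n"
    and no_alarm: "\<And>j. i \<le> j \<Longrightarrow> j \<le> m \<Longrightarrow>
      e j * (1 + reverse_sr c (map e [Suc j..<Suc n])) < c"
  shows "reverse_sum (map e [i..<Suc m]) \<le> reverse_sr c (map e [i..<Suc n])"
  using \<open>i \<le> Suc m\<close> nn no_alarm
proof (induction i rule: inc_induct)
  case base
  then have "\<forall>x\<in>set (map e [Suc m..<Suc n]). 0 \<le> x" by auto
  from reverse_sr_nonneg[OF this] show ?case by simp
next
  case (step i)
  have upt: "[i..<Suc m] = i # [Suc i..<Suc m]" "[i..<Suc n] = i # [Suc i..<Suc n]"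
    using step \<open>m \<le> n\<close> by (simp_all add: upt_conv_Cons)
  have "reverse_sum (map e [Suc i..<Suc m]) \<le> reverse_sr c (map e [Suc i..<Suc n])"
    using step.prems by (intro step.IH) auto
  moreover have "0 \<le> e i" "e i * (1 + reverse_sr c (map e [Suc i..<Suc n])) < c"
    using step \<open>m \<le> n\<close> by auto
  ultimately show ?case
    unfolding upt by (simp add: mult_left_mono)
qed

text \<open>The intervals between consecutive forward alarms are disjoint, so choosing one backward
  alarm in each is injective. The argument is pathwise.\<close>

lemma num_alarms_le_reverse_alarms:
  assumes nn: "\<And>j. 1 \<le> j \<Longrightarrow> 0 \<le> e j"
  shows "num_alarms c e n \<le> reverse_alarms c (map e [1..<Suc n])"
proof -
  let ?\<tau> = "alarm_time c e"
  define B where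
    "B = {j\<in>{1..n}. c \<le> e j * (1 + reverse_sr c (map e [Suc j..<Suc n]))}"
  define K where "K = num_alarms c e n"
  have "K \<in> {k. ?\<tau> k \<le> enat n}"
    unfolding K_def num_alarms_def
    by (intro Max_in finite_alarms) (auto intro!: exI[of _ 0])
  then have K: "?\<tau> K \<le> enat n" by simp
  have mono_Suc: "?\<tau> k \<le> ?\<tau> (Suc k)" for k
    unfolding alarm_time.simps by (intro Inf_greatest) auto
  have mono: "?\<tau> k \<le> ?\<tau> l" if "k \<le> l" for k l
    by (rule lift_Suc_mono_le[of ?\<tau> k l, OF mono_Suc that])
  have ex: "\<exists>i\<in>B. ?\<tau> k < enat i \<and> enat i \<le> ?\<tau> (Suc k)" if "k < K" for k
  proof -
    define S where "S = {n. ?\<tau> k < enat n \<and>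
            Max ((\<lambda>i. \<Sum>j=i..n. \<Prod>l=i..j. e l) ` {i. ?\<tau> k < enat i \<and> i \<le> n}) \<ge> c}"
    have \<tau>_Suc: "?\<tau> (Suc k) = Inf (enat ` S)"
      unfolding S_def by (rule alarm_time.simps)
    have le: "?\<tau> (Suc k) \<le> enat n"
      using mono[of "Suc k" K] that K by (meson Suc_leI order_trans)
    \<comment> \<open>An empty \<open>S\<close> would have infimum \<open>\<infinity>\<close>, but
      this alarm time is at most \<open>n\<close>. Hence the infimum is attained, at some
      \<open>m\<close> in \<open>S\<close>.\<close>
    have "S \<noteq> {}"
    proof
      assume "S = {}"
      then show False using le unfolding \<tau>_Suc by (simp add: Inf_enat_def)
    qed
    then have "Inf (enat ` S) \<in> enat ` S"
      using wellorder_InfI by (metis empty_is_image ex_in_conv)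
    then obtain m where \<tau>_m: "?\<tau> (Suc k) = enat m" and "m \<in> S"
      unfolding \<tau>_Suc by blast
    then have m: "?\<tau> k < enat m"
        "c \<le> Max ((\<lambda>i. \<Sum>j=i..m. \<Prod>l=i..j. e l) ` {i. ?\<tau> k < enat i \<and> i \<le> m})"
      unfolding S_def by auto
    let ?I = "{i. ?\<tau> k < enat i \<and> i \<le> m}"
    have "finite ?I" "?I \<noteq> {}" using m by auto
    then have "Max ((\<lambda>i. \<Sum>j=i..m. \<Prod>l=i..j. e l) ` ?I)
        \<in> (\<lambda>i. \<Sum>j=i..m. \<Prod>l=i..j. e l) ` ?I"
      by (intro Max_in) auto
    then obtain i where i: "?\<tau> k < enat i" "i \<le> m" "c \<le> (\<Sum>j=i..m. \<Prod>l=i..j. e l)"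
      using m by auto
    \<comment> \<open>The strict inequality \<open>?\<tau> k < enat i\<close> excludes index
      \<open>0\<close>, where the sign of \<open>e\<close> is unknown.\<close>
    have "1 \<le> i"
      using i(1) by (cases i) (auto simp: zero_enat_def[symmetric])
    have "m \<le> n" using le \<tau>_m by simp
    \<comment> \<open>Without a backward alarm in \<open>{i..m}\<close> the recursion is never reset there, and its state
      before step \<open>m\<close> is non-negative, so it dominates the sum that triggered the forward alarm.\<close>
    have "\<exists>j\<in>{i..m}. c \<le> e j * (1 + reverse_sr c (map e [Suc j..<Suc n]))"
    proof (rule ccontr)
      assume "\<not> ?thesis"
      then have less: "e j * (1 + reverse_sr c (map e [Suc j..<Suc n])) < c"
        if "i \<le> j" "j \<le> m" for j using that by force
      have "c \<le> reverse_sum (map e [i..<Suc m])"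
        using i reverse_sum_map_upt[of i m e] by simp
      also have "\<dots> \<le> reverse_sr c (map e [i..<Suc n])"
        using nn \<open>1 \<le> i\<close> \<open>m \<le> n\<close> i less by (intro reverse_sr_ge_reverse_sum) auto
      also have "\<dots> = e i * (1 + reverse_sr c (map e [Suc i..<Suc n]))"
        using less[of i] i \<open>m \<le> n\<close> by (subst upt_conv_Cons) auto
      finally show False using less[of i] i by simp
    qed
    then obtain j where j: "j \<in> {i..m}" "c \<le> e j * (1 + reverse_sr c (map e [Suc j..<Suc n]))"
      by blast
    have "?\<tau> k < enat j" using i(1) j(1) by (auto intro: less_le_trans)
    then show ?thesis
      using j \<tau>_m \<open>1 \<le> i\<close> \<open>m \<le> n\<close> unfolding B_def by (intro bexI[of _ j]) auto
  qed
  then obtain g where g: "\<And>k. k < K \<Longrightarrow> g k \<in> B \<and> ?\<tau> k < enat (g k) \<and> enat (g k) \<le> ?\<tau> (Suc k)"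
    by metis
  have lt: "g k < g l" if "k < l" "l < K" for k l
  proof -
    have "enat (g k) \<le> ?\<tau> (Suc k)" using g that by auto
    also have "\<dots> \<le> ?\<tau> l" using that by (intro mono) auto
    also have "\<dots> < enat (g l)" using g that by auto
    finally show ?thesis by simp
  qed
  have "inj_on g {..<K}"
    by (intro inj_onI) (metis lessThan_iff less_irrefl linorder_neqE_nat lt)
  moreover have "g ` {..<K} \<subseteq> B" using g by auto
  moreover have "finite B" unfolding B_def by auto
  ultimately have "K \<le> card B"
    by (metis card_image card_lessThan card_mono)
  also have "\<dots> = reverse_alarms c (map e [1..<Suc n])"
    unfolding B_def by (subst reverse_alarms_map_upt) auto
  finally show ?thesis unfolding K_def .
qed

section \<open>Exponential bound for one backward step\<close>

text \<open>For \<open>y = - t < 0\<close> the claim is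
  \<open>1 \<le> (1 - t + t\<^sup>2) * exp t\<close>; it follows from the quadratic Taylor lower
  bound for \<open>exp t\<close>, as the resulting product only adds non-negative terms to
  \<open>1\<close>.\<close>

lemma exp_le_quadratic:
  fixes y :: real
  assumes "\<bar>y\<bar> \<le> 1"
  shows "exp y \<le> 1 + y + y\<^sup>2"
proof (cases "0 \<le> y")
  case True
  then show ?thesis using assms by (intro exp_bound) auto
next
  case False
  define t where "t = - y"
  have t: "0 < t" "t \<le> 1" using False assms by (auto simp: t_def)
  have "1 \<le> 1 + (t^2 + t^3 + t^4) / 2" using t by simp
  also have "\<dots> = (1 - t + t\<^sup>2) * (1 + t + t\<^sup>2 / 2)"
    by (simp add: field_simps power2_eq_square power3_eq_cube power4_eq_xxxx)
  also have "\<dots> \<le> (1 - t + t\<^sup>2) * exp t"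
    using t exp_lower_Taylor_quadratic[of t] by (intro mult_left_mono) auto
  finally have "exp (- t) \<le> 1 - t + t\<^sup>2"
    by (simp add: exp_minus field_simps)
  then show ?thesis by (simp add: t_def)
qed

text \<open>The candidate for an exponential supermartingale in reversed time, up to a factor close
  to \<open>1\<close> per step. The compensator is the number of steps, so an excess of alarms over
  \<open>length xs / c\<close> makes it large.\<close>

definition exp_alarms :: "real \<Rightarrow> real \<Rightarrow> real list \<Rightarrow> real" where
  "exp_alarms c s xs =
     exp (s * (c * real (reverse_alarms c xs) + reverse_sr c xs - real (length xs)))"

text \<open>Second-order expansion of one increment. The linear term is kept in the form
  \<open>x - 1\<close> times a function of \<open>xs\<close>, because its integral will be
  non-positive; only the quadratic term is estimated by a constant.\<close>

lemma exp_alarms_Cons_le: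
  assumes "0 \<le> c" "0 \<le> x" "\<forall>x\<in>set xs. 0 \<le> x" "0 \<le> s" "s * (c + 1) \<le> 1"
  shows "exp_alarms c s (x # xs) \<le> (1 + (s * (c + 1))\<^sup>2) * exp_alarms c s xs
    + s * ((x - 1) * ((1 + reverse_sr c xs) * exp_alarms c s xs))"
proof -
  define r where "r = reverse_sr c xs"
  have r: "0 \<le> r" "r \<le> c"
    using assms reverse_sr_nonneg reverse_sr_le unfolding r_def by auto
  \<comment> \<open>The exact increment of the exponent in both cases: an alarm trades the state for
    \<open>c\<close>, otherwise the state becomes \<open>x * (1 + r)\<close>. Dropping the minimum
    gives \<open>d \<le> (x - 1) * (1 + r)\<close>.\<close>
  define d where "d = min (x * (1 + r)) c - r - 1"
  have "0 \<le> x * (1 + r)" using assms r by simp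
  then have d: "\<bar>d\<bar> \<le> c + 1"
    using r assms(1) unfolding d_def min_def by (smt (verit))
  have "\<bar>s * d\<bar> \<le> s * (c + 1)"
    using d assms by (simp add: abs_mult mult_left_mono)
  then have sd: "\<bar>s * d\<bar> \<le> 1" "(s * d)\<^sup>2 \<le> (s * (c + 1))\<^sup>2"
    using assms by (auto simp: abs_le_square_iff[symmetric])
  have "s * d \<le> s * ((x - 1) * (1 + r))"
    using assms by (intro mult_left_mono) (auto simp: d_def algebra_simps)
  then have "exp (s * d) \<le> 1 + s * ((x - 1) * (1 + r)) + (s * (c + 1))\<^sup>2"
    using exp_le_quadratic[OF sd(1)] sd(2) by linarith
  moreover have "c * real (reverse_alarms c (x # xs)) + reverse_sr c (x # xs) - real (length (x # xs))
      = (c * real (reverse_alarms c xs) + reverse_sr c xs - real (length xs)) + d"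
    unfolding d_def r_def by (auto simp: algebra_simps min_def)
  then have "exp_alarms c s (x # xs) = exp_alarms c s xs * exp (s * d)"
    unfolding exp_alarms_def exp_add[symmetric] by (simp only: distrib_left)
  moreover have "0 \<le> exp_alarms c s xs" by (simp add: exp_alarms_def)
  ultimately have "exp_alarms c s (x # xs)
      \<le> exp_alarms c s xs * (1 + s * ((x - 1) * (1 + r)) + (s * (c + 1))\<^sup>2)"
    by (simp add: mult_left_mono)
  then show ?thesis unfolding r_def by (simp add: algebra_simps)
qed

text \<open>A crude bound depending on \<open>xs\<close> only through its length; it serves to make
  the later integrands bounded.\<close>

lemma exp_alarms_le:
  assumes "0 \<le> c" "0 \<le> s"
  shows "exp_alarms c s xs \<le> exp (s * (c * real (length xs) + c))"
proof -
  have "c * real (reverse_alarms c xs) \<le> c * real (length xs)"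
    using assms reverse_alarms_le_length by (intro mult_left_mono) auto
  then have "c * real (reverse_alarms c xs) + reverse_sr c xs - real (length xs)
      \<le> c * real (length xs) + c"
    using reverse_sr_le[OF assms(1), of xs] by linarith
  then show ?thesis
    unfolding exp_alarms_def using assms by (simp add: mult_left_mono)
qed

section \<open>Measurability of the backward recursion\<close>

lemma measurable_reverse_sr:
  assumes "\<And>i. i \<in> set is \<Longrightarrow> X i \<in> borel_measurable M"
  shows "(\<lambda>x. reverse_sr c (map (\<lambda>i. X i x) is)) \<in> borel_measurable M"
  using assms
proof (induction "is")
  case (Cons a as)
  have [measurable]: "X a \<in> borel_measurable M"
    "(\<lambda>x. reverse_sr c (map (\<lambda>i. X i x) as)) \<in> borel_measurable M"
    using Cons by auto
  show ?case by simp
qed simp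

lemma measurable_reverse_alarms:
  assumes "\<And>i. i \<in> set is \<Longrightarrow> X i \<in> borel_measurable M"
  shows "(\<lambda>x. reverse_alarms c (map (\<lambda>i. X i x) is)) \<in> measurable M (count_space UNIV)"
  using assms
proof (induction "is")
  case (Cons a as)
  have [measurable]: "X a \<in> borel_measurable M"
    "(\<lambda>x. reverse_sr c (map (\<lambda>i. X i x) as)) \<in> borel_measurable M"
    "(\<lambda>x. reverse_alarms c (map (\<lambda>i. X i x) as)) \<in> measurable M (count_space UNIV)"
    using Cons by (auto intro!: measurable_reverse_sr)
  show ?case by simp
qed simp

lemma measurable_exp_alarms:
  assumes "\<And>i. i \<in> set is \<Longrightarrow> X i \<in> borel_measurable M"
  shows "(\<lambda>x. exp_alarms c s (map (\<lambda>i. X i x) is)) \<in> borel_measurable M"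
proof -
  have [measurable]: "(\<lambda>x. reverse_sr c (map (\<lambda>i. X i x) is)) \<in> borel_measurable M"
    "(\<lambda>x. reverse_alarms c (map (\<lambda>i. X i x) is)) \<in> measurable M (count_space UNIV)"
    using assms by (auto intro!: measurable_reverse_sr measurable_reverse_alarms)
  show ?thesis unfolding exp_alarms_def by simp
qed

section \<open>Conformal e-predictors\<close>

text \<open>On sequences of length \<open>n\<close>, \<open>last\<close> is the coordinate
  projection with index \<open>n - 1\<close>.\<close>

lemma measurable_last_nonempty_seqs: "last \<in> nonempty_seqs X \<rightarrow>\<^sub>M X"
proof (rule measurableI)
  fix xs assume "xs \<in> space (nonempty_seqs X)"
  then show "last xs \<in> space X" by (auto simp: space_nonempty_seqs)
next
  fix B assume B: "B \<in> sets X"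
  have "(\<lambda>x. map x [0..<n]) -` (last -` B \<inter> {xs. xs \<noteq> [] \<and> set xs \<subseteq> space X})
      \<inter> space (\<Pi>\<^sub>M i\<in>{..<n}. X) \<in> sets (\<Pi>\<^sub>M i\<in>{..<n}. X)" if "n \<ge> 1" for n
  proof -
    have "(\<lambda>x. map x [0..<n]) -` (last -` B \<inter> {xs. xs \<noteq> [] \<and> set xs \<subseteq> space X})
        \<inter> space (\<Pi>\<^sub>M i\<in>{..<n}. X) = (\<lambda>x. x (n - 1)) -` B \<inter> space (\<Pi>\<^sub>M i\<in>{..<n}. X)"
      using that map_upt_in_nonempty_seqs[of _ n X] by (auto simp: last_map)
    also have "\<dots> \<in> sets (\<Pi>\<^sub>M i\<in>{..<n}. X)"
      using B that by (intro measurable_sets[OF measurable_component_singleton]) auto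
    finally show ?thesis .
  qed
  then show "last -` B \<inter> space (nonempty_seqs X) \<in> sets (nonempty_seqs X)"
    unfolding space_nonempty_seqs by (auto simp: sets_nonempty_seqs)
qed

lemma measurable_map_upt_nonempty_seqs:
  assumes "1 \<le> i" "i \<le> n"
  shows "(\<lambda>z. map z [1..<Suc i]) \<in> (\<Pi>\<^sub>M j\<in>{1..n}. X) \<rightarrow>\<^sub>M nonempty_seqs X"
proof (rule measurableI)
  fix z assume "z \<in> space (\<Pi>\<^sub>M j\<in>{1..n}. X)"
  then show "map z [1..<Suc i] \<in> space (nonempty_seqs X)"
    using assms by (auto simp: space_nonempty_seqs space_PiM PiE_def Pi_def)
next
  fix B assume "B \<in> sets (nonempty_seqs X)"
  then have B: "(\<lambda>x. map x [0..<i]) -` B \<inter> space (\<Pi>\<^sub>M j\<in>{..<i}. X) \<in> sets (\<Pi>\<^sub>M j\<in>{..<i}. X)"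
    using assms by (auto simp: sets_nonempty_seqs)
  \<comment> \<open>Sequences of random elements start at index \<open>1\<close>, the products
    defining \<open>nonempty_seqs\<close> at index \<open>0\<close>; this map truncates and
    reindexes.\<close>
  have shift: "(\<lambda>z. \<lambda>k\<in>{..<i}. z (Suc k)) \<in> (\<Pi>\<^sub>M j\<in>{1..n}. X) \<rightarrow>\<^sub>M (\<Pi>\<^sub>M j\<in>{..<i}. X)"
    using assms by (intro measurable_restrict measurable_component_singleton) auto
  have "map (\<lambda>k\<in>{..<i}. z (Suc k)) [0..<i] = map z [1..<Suc i]" for z :: "nat \<Rightarrow> 'a"
    by (rule nth_equalityI) (auto simp del: upt_Suc)
  then have "(\<lambda>z. map z [1..<Suc i]) -` B \<inter> space (\<Pi>\<^sub>M j\<in>{1..n}. X)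
      = (\<lambda>z. \<lambda>k\<in>{..<i}. z (Suc k)) -` ((\<lambda>x. map x [0..<i]) -` B \<inter> space (\<Pi>\<^sub>M j\<in>{..<i}. X))
        \<inter> space (\<Pi>\<^sub>M j\<in>{1..n}. X)"
    using measurable_space[OF shift] by auto
  also have "\<dots> \<in> sets (\<Pi>\<^sub>M j\<in>{1..n}. X)"
    by (rule measurable_sets[OF shift B])
  finally show "(\<lambda>z. map z [1..<Suc i]) -` B \<inter> space (\<Pi>\<^sub>M j\<in>{1..n}. X)
      \<in> sets (\<Pi>\<^sub>M j\<in>{1..n}. X)" .
qed

lemma conformal_e_predictor_measurable:
  assumes "conformal_e_predictor N f"
  shows "f \<in> borel_measurable (nonempty_seqs N)"
proof -
  obtain A where A: "A \<in> nonempty_seqs N \<rightarrow>\<^sub>M nonempty_seqs (restrict_space borel {0..})"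
    "\<forall>zs\<in>space (nonempty_seqs N). f zs = last (A zs)"
    using assms unfolding conformal_e_predictor_def nonconformity_e_measure_def by blast
  have "(\<lambda>zs. last (A zs)) \<in> nonempty_seqs N \<rightarrow>\<^sub>M restrict_space borel {0..}"
    by (rule measurable_compose[OF A(1) measurable_last_nonempty_seqs])
  then have "(\<lambda>zs. last (A zs)) \<in> borel_measurable (nonempty_seqs N)"
    by (simp add: measurable_restrict_space2_iff)
  then show ?thesis
    using A(2) by (subst measurable_cong) auto
qed

text \<open>Exchanging position \<open>j\<close> with the last one moves the \<open>j\<close>-th
  score to the end, so the sum in the second claim is the sum of all scores. Exchanging two earlier
  positions leaves the last score in place.\<close>

lemma
  assumes "conformal_e_predictor N f" "zs \<in> space (nonempty_seqs N)"
  shows conformal_e_predictor_nonneg: "0 \<le> f zs"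
    and conformal_e_predictor_sum_le:
      "(\<Sum>j<length zs. f (permute_list (Transposition.transpose j (length zs - 1)) zs)) \<le> real (length zs)"
    and conformal_e_predictor_permute:
      "a < length zs - 1 \<Longrightarrow> b < length zs - 1 \<Longrightarrow> f (permute_list (Transposition.transpose a b) zs) = f zs"
proof -
  obtain A where A: "A \<in> nonempty_seqs N \<rightarrow>\<^sub>M nonempty_seqs (restrict_space borel {0..})"
    "\<And>zs. zs \<in> space (nonempty_seqs N) \<Longrightarrow> length (A zs) = length zs"
    "\<And>zs. zs \<in> space (nonempty_seqs N) \<Longrightarrow>
      (1 / real (length zs)) * (\<Sum>i<length zs. A zs ! i) \<le> 1"
    "\<And>zs \<pi>. zs \<in> space (nonempty_seqs N) \<Longrightarrow> \<pi> permutes {..<length zs} \<Longrightarrow>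
      A (permute_list \<pi> zs) = permute_list \<pi> (A zs)"
    "\<And>zs. zs \<in> space (nonempty_seqs N) \<Longrightarrow> f zs = last (A zs)"
    using assms(1) unfolding conformal_e_predictor_def nonconformity_e_measure_def by blast
  have zs: "zs \<noteq> []" using assms(2) by (simp add: space_nonempty_seqs)
  have "A zs \<noteq> []" "set (A zs) \<subseteq> {0..}"
    using measurable_space[OF A(1) assms(2)]
    by (auto simp: space_nonempty_seqs space_restrict_space)
  then show "0 \<le> f zs"
    using A(5)[OF assms(2)] last_in_set[of "A zs"] by fastforce
  have f: "f (permute_list (Transposition.transpose a b) zs) = A zs ! Transposition.transpose a b (length zs - 1)"
    if "a < length zs" "b < length zs" for a b
  proof -
    have p: "Transposition.transpose a b permutes {..<length zs}"
      using that by (intro permutes_swap_id) auto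
    then have "permute_list (Transposition.transpose a b) zs \<in> space (nonempty_seqs N)"
      using assms(2) by (auto simp: space_nonempty_seqs simp flip: length_greater_0_conv)
    then have "f (permute_list (Transposition.transpose a b) zs) = last (permute_list (Transposition.transpose a b) (A zs))"
      using A(4)[OF assms(2) p] A(5) by simp
    also have "\<dots> = permute_list (Transposition.transpose a b) (A zs) ! (length zs - 1)"
      using A(2)[OF assms(2)] zs by (subst last_conv_nth) (auto simp flip: length_greater_0_conv)
    also have "\<dots> = A zs ! Transposition.transpose a b (length zs - 1)"
      using A(2)[OF assms(2)] zs p by (subst permute_list_nth) auto
    finally show ?thesis .
  qed
  have "(\<Sum>j<length zs. f (permute_list (Transposition.transpose j (length zs - 1)) zs))
      = (\<Sum>j<length zs. A zs ! j)"
    using zs by (intro sum.cong) (auto simp: f)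
  also have "\<dots> \<le> real (length zs)"
    using A(3)[OF assms(2)] zs by (simp add: field_simps)
  finally show "(\<Sum>j<length zs. f (permute_list (Transposition.transpose j (length zs - 1)) zs))
    \<le> real (length zs)" .
  show "f (permute_list (Transposition.transpose a b) zs) = f zs"
    if "a < length zs - 1" "b < length zs - 1"
  proof -
    have "f zs = A zs ! (length zs - 1)"
      using A(2)[OF assms(2)] A(5)[OF assms(2)] zs
      by (subst (asm) last_conv_nth) (auto simp flip: length_greater_0_conv)
    moreover have "Transposition.transpose a b (length zs - 1) = length zs - 1"
      using that by (intro transpose_apply_other) auto
    ultimately show ?thesis using f[of a b] that by simp
  qed
qed

text \<open>The value is one term of a sum of non-negative scores, namely the one with the trivial
  transposition. This boundedness gives integrability later.\<close>

lemma conformal_e_predictor_le_length: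
  assumes "conformal_e_predictor N f" "zs \<in> space (nonempty_seqs N)"
  shows "f zs \<le> real (length zs)"
proof -
  have zs: "zs \<noteq> []" using assms(2) by (simp add: space_nonempty_seqs)
  have "f (permute_list (Transposition.transpose (length zs - 1) (length zs - 1)) zs)
      \<le> (\<Sum>j<length zs. f (permute_list (Transposition.transpose j (length zs - 1)) zs))"
  proof (rule member_le_sum)
    fix j assume "j \<in> {..<length zs} - {length zs - 1}"
    then have "Transposition.transpose j (length zs - 1) permutes {..<length zs}"
      by (intro permutes_swap_id) auto
    then have "permute_list (Transposition.transpose j (length zs - 1)) zs \<in> space (nonempty_seqs N)"
      using assms(2) by (auto simp: space_nonempty_seqs simp flip: length_greater_0_conv)
    then show "0 \<le> f (permute_list (Transposition.transpose j (length zs - 1)) zs)"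
      by (rule conformal_e_predictor_nonneg[OF assms(1)])
  qed (use zs in auto)
  also have "\<dots> \<le> real (length zs)"
    by (rule conformal_e_predictor_sum_le[OF assms])
  finally show ?thesis by simp
qed

text \<open>Translates between transpositions of the indices from \<open>1\<close> of the random
  sequence and of list positions from \<open>0\<close>.\<close>

lemma map_transpose_upt:
  assumes "a < l" "b < l"
  shows "map (z \<circ> Transposition.transpose (Suc a) (Suc b)) [1..<Suc l]
    = permute_list (Transposition.transpose a b) (map z [1..<Suc l])"
proof (rule nth_equalityI)
  fix k assume "k < length (map (z \<circ> Transposition.transpose (Suc a) (Suc b)) [1..<Suc l])"
  then have k: "k < l" by (simp del: upt_Suc)
  have p: "Transposition.transpose a b permutes {..<l}"
    using assms by (intro permutes_swap_id) auto
  have "Transposition.transpose a b k < l"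
    using permutes_in_image[OF p, of k] k by simp
  then show "map (z \<circ> Transposition.transpose (Suc a) (Suc b)) [1..<Suc l] ! k
      = permute_list (Transposition.transpose a b) (map z [1..<Suc l]) ! k"
    using k p by (subst permute_list_nth) (auto simp: Transposition.transpose_def simp del: upt_Suc)
qed simp

text \<open>
  Exchanging \<open>Z\<^sub>i\<close> with \<open>Z\<^sub>j\<close>, \<open>j \<le> i\<close>, turns \<open>e\<^sub>i\<close> into the \<open>j\<close>-th nonconformity score of
  \<open>Z\<^sub>1, \<dots>, Z\<^sub>i\<close> and keeps the later e-values. All these scores therefore have the same integral
  against \<open>g\<close>, and their average is at most \<open>1\<close>.
\<close>

lemma integral_e_value_mult_le:
  fixes g :: "real list \<Rightarrow> real"
  assumes f: "conformal_e_predictor N f" and M: "prob_space M" and Z: "exchangeable M N Z"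
    and i: "1 \<le> i" "i \<le> n"
    and meas: "(\<lambda>z. g (map (\<lambda>l. f (map z [1..<Suc l])) [Suc i..<Suc n]))
      \<in> borel_measurable (\<Pi>\<^sub>M j\<in>{1..n}. N)"
    and bound: "\<And>xs. \<forall>x\<in>set xs. 0 \<le> x \<Longrightarrow> length xs = n - i \<Longrightarrow> 0 \<le> g xs \<and> g xs \<le> C"
  shows "integrable M (\<lambda>\<omega>. conformal_e_value f Z \<omega> i
      * g (map (conformal_e_value f Z \<omega>) [Suc i..<Suc n]))" (is ?int)
    and "integrable M (\<lambda>\<omega>. g (map (conformal_e_value f Z \<omega>) [Suc i..<Suc n]))" (is ?int')
    and "(\<integral>\<omega>. conformal_e_value f Z \<omega> i
      * g (map (conformal_e_value f Z \<omega>) [Suc i..<Suc n]) \<partial>M)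
      \<le> (\<integral>\<omega>. g (map (conformal_e_value f Z \<omega>) [Suc i..<Suc n]) \<partial>M)" (is ?le)
proof -
  interpret prob_space M by (rule M)
  let ?P = "\<Pi>\<^sub>M j\<in>{1..n}. N"
  define ev where "ev z l = f (map z [1..<Suc l])" for z l
  define h where "h z = g (map (ev z) [Suc i..<Suc n])" for z
  define X where "X \<pi> \<omega> = (\<lambda>j\<in>{1..n}. Z (\<pi> j) \<omega>)" for \<pi> \<omega>
  \<comment> \<open>Here \<open>j\<close> is a list position, so \<open>Suc j\<close> is the index
    exchanged with \<open>i\<close>; \<open>j = i - 1\<close> gives the identity.\<close>
  define T where "T j = Transposition.transpose (Suc j) i" for j
  have T: "T j permutes {1..n}" if "j < i" for j
    unfolding T_def using that i by (intro permutes_swap_id) auto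
  have X: "X \<pi> \<in> M \<rightarrow>\<^sub>M ?P" if "\<pi> permutes {1..n}" for \<pi>
    unfolding X_def
  proof (rule measurable_restrict)
    fix j assume "j \<in> {1..n}"
    then have "1 \<le> \<pi> j" using permutes_in_image[OF that, of j] by auto
    then show "Z (\<pi> j) \<in> M \<rightarrow>\<^sub>M N" using Z by (auto simp: exchangeable_def)
  qed
  have distr: "distr M ?P (X \<pi>) = distr M ?P (X id)" if "\<pi> permutes {1..n}" for \<pi>
    using Z that i unfolding exchangeable_def X_def by auto
  have seq: "map z [1..<Suc l] \<in> space (nonempty_seqs N)"
    if "z \<in> space ?P" "1 \<le> l" "l \<le> n" for z l
    using measurable_space[OF measurable_map_upt_nonempty_seqs that(1)] that by blast
  have ev_bounds: "0 \<le> ev z l" "ev z l \<le> real l"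
    if "z \<in> space ?P" "1 \<le> l" "l \<le> n" for z l
    using conformal_e_predictor_nonneg[OF f seq[OF that]]
      conformal_e_predictor_le_length[OF f seq[OF that]]
    unfolding ev_def by (simp_all del: upt_Suc)
  have h_bounds: "0 \<le> h z" "h z \<le> C" if "z \<in> space ?P" for z
    using bound[of "map (ev z) [Suc i..<Suc n]"] ev_bounds[OF that]
    unfolding h_def by auto
  have meas_h: "h \<in> borel_measurable ?P"
    using meas unfolding h_def ev_def .
  have meas_ev: "(\<lambda>z. ev z i) \<in> borel_measurable ?P"
    unfolding ev_def using i
    by (intro measurable_compose[OF measurable_map_upt_nonempty_seqs
          conformal_e_predictor_measurable[OF f]])
  have space_X: "X \<pi> \<omega> \<in> space ?P" if "\<pi> permutes {1..n}" "\<omega> \<in> space M" for \<pi> \<omega>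
    using measurable_space[OF X] that by blast
  have ev_T: "ev (X (T j) \<omega>) l = f (permute_list (Transposition.transpose j (i - 1))
      (map (X id \<omega>) [1..<Suc l]))" if "j < i" "i \<le> l" "l \<le> n" for j l \<omega>
  proof -
    have "map (X (T j) \<omega>) [1..<Suc l] = map (X id \<omega> \<circ> T j) [1..<Suc l]"
    proof (rule map_cong[OF refl])
      fix k assume "k \<in> set [1..<Suc l]"
      then have "k \<in> {1..n}" using that by auto
      then show "X (T j) \<omega> k = (X id \<omega> \<circ> T j) k"
        using permutes_in_image[OF T[OF that(1)], of k] by (auto simp: X_def)
    qed
    also have "X id \<omega> \<circ> T j = X id \<omega> \<circ> Transposition.transpose (Suc j) (Suc (i - 1))"
      using i by (simp add: T_def)
    also have "map (X id \<omega> \<circ> Transposition.transpose (Suc j) (Suc (i - 1))) [1..<Suc l]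
        = permute_list (Transposition.transpose j (i - 1)) (map (X id \<omega>) [1..<Suc l])"
      using that i by (intro map_transpose_upt) auto
    finally show ?thesis by (simp only: ev_def)
  qed
  \<comment> \<open>For \<open>l > i\<close> the last list position \<open>l - 1\<close> lies beyond
    both exchanged positions \<open>j\<close> and \<open>i - 1\<close>, so no e-value entering
    \<open>h\<close> changes.\<close>
  have h_T: "h (X (T j) \<omega>) = h (X id \<omega>)" if "j < i" and \<omega>: "\<omega> \<in> space M" for j \<omega>
  proof -
    have "ev (X (T j) \<omega>) l = ev (X id \<omega>) l" if l: "i < l" "l \<le> n" for l
    proof -
      have "f (permute_list (Transposition.transpose j (i - 1)) (map (X id \<omega>) [1..<Suc l]))
          = f (map (X id \<omega>) [1..<Suc l])"
        using \<open>j < i\<close> l i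
        by (intro conformal_e_predictor_permute[OF f] seq space_X[OF permutes_id \<omega>]) auto
      then show ?thesis using ev_T[of j l \<omega>] \<open>j < i\<close> l by (simp add: ev_def)
    qed
    then have "map (ev (X (T j) \<omega>)) [Suc i..<Suc n] = map (ev (X id \<omega>)) [Suc i..<Suc n]"
      by (intro map_cong) auto
    then show ?thesis unfolding h_def by (simp only:)
  qed
  have int_T: "integrable M (\<lambda>\<omega>. ev (X (T j) \<omega>) i * h (X id \<omega>))"
    if "j < i" for j
  proof (rule integrable_const_bound)
    show "(\<lambda>\<omega>. ev (X (T j) \<omega>) i * h (X id \<omega>)) \<in> borel_measurable M"
      by (intro borel_measurable_times measurable_compose[OF X meas_ev]
          measurable_compose[OF X meas_h] T[OF that] permutes_id)
    show "AE \<omega> in M. norm (ev (X (T j) \<omega>) i * h (X id \<omega>)) \<le> real i * C"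
    proof (rule AE_I2)
      fix \<omega> assume "\<omega> \<in> space M"
      then have *: "X (T j) \<omega> \<in> space ?P" "X id \<omega> \<in> space ?P"
        by (intro space_X T[OF that] permutes_id; assumption)+
      show "norm (ev (X (T j) \<omega>) i * h (X id \<omega>)) \<le> real i * C"
        using ev_bounds[OF *(1) i] h_bounds[OF *(2)]
        by (simp add: abs_mult mult_mono)
    qed
  qed
  have int_h: "integrable M (\<lambda>\<omega>. h (X id \<omega>))"
  proof (rule integrable_const_bound)
    show "(\<lambda>\<omega>. h (X id \<omega>)) \<in> borel_measurable M"
      by (rule measurable_compose[OF X[OF permutes_id] meas_h])
    show "AE \<omega> in M. norm (h (X id \<omega>)) \<le> C"
    proof (rule AE_I2)
      fix \<omega> assume "\<omega> \<in> space M"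
      from h_bounds[OF space_X[OF permutes_id this]] show "norm (h (X id \<omega>)) \<le> C" by simp
    qed
  qed
  have T_id: "T (i - 1) = id" using i by (simp add: T_def)
  have int_swap: "(\<integral>\<omega>. ev (X (T j) \<omega>) i * h (X id \<omega>) \<partial>M) = (\<integral>\<omega>. ev (X id \<omega>) i * h (X id \<omega>) \<partial>M)"
    if "j < i" for j
  proof -
    have meas_prod: "(\<lambda>z. ev z i * h z) \<in> borel_measurable ?P"
      by (intro borel_measurable_times meas_ev meas_h)
    \<comment> \<open>By \<open>h_T\<close> the integrand is a single function of
      \<open>X (T j)\<close>, whose distribution equals that of \<open>X id\<close> by
      exchangeability.\<close>
    have "(\<integral>\<omega>. ev (X (T j) \<omega>) i * h (X id \<omega>) \<partial>M)
        = (\<integral>\<omega>. ev (X (T j) \<omega>) i * h (X (T j) \<omega>) \<partial>M)"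
      using h_T[OF that] by (intro Bochner_Integration.integral_cong) auto
    also have "\<dots> = (\<integral>z. ev z i * h z \<partial>distr M ?P (X (T j)))"
      by (rule integral_distr[symmetric, OF X[OF T[OF that]] meas_prod])
    also have "\<dots> = (\<integral>z. ev z i * h z \<partial>distr M ?P (X id))"
      using distr[OF T[OF that]] by simp
    also have "\<dots> = (\<integral>\<omega>. ev (X id \<omega>) i * h (X id \<omega>) \<partial>M)"
      by (rule integral_distr[OF X[OF permutes_id] meas_prod])
    finally show ?thesis .
  qed
  have "real i * (\<integral>\<omega>. ev (X id \<omega>) i * h (X id \<omega>) \<partial>M)
      = (\<Sum>j<i. \<integral>\<omega>. ev (X (T j) \<omega>) i * h (X id \<omega>) \<partial>M)"
    by (simp add: int_swap)
  also have "\<dots> = (\<integral>\<omega>. (\<Sum>j<i. ev (X (T j) \<omega>) i * h (X id \<omega>)) \<partial>M)"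
    using int_T by (subst Bochner_Integration.integral_sum) auto
  also have "\<dots> \<le> (\<integral>\<omega>. real i * h (X id \<omega>) \<partial>M)"
  proof (rule integral_mono)
    show "integrable M (\<lambda>\<omega>. \<Sum>j<i. ev (X (T j) \<omega>) i * h (X id \<omega>))"
      using int_T by (intro Bochner_Integration.integrable_sum) auto
    show "integrable M (\<lambda>\<omega>. real i * h (X id \<omega>))" using int_h by simp
    fix \<omega> assume "\<omega> \<in> space M"
    then have sp: "X id \<omega> \<in> space ?P" by (intro space_X permutes_id)
    have "(\<Sum>j<i. ev (X (T j) \<omega>) i) \<le> real i"
      using conformal_e_predictor_sum_le[OF f seq[OF sp i]] i
      by (simp add: ev_T del: upt_Suc)
    then show "(\<Sum>j<i. ev (X (T j) \<omega>) i * h (X id \<omega>)) \<le> real i * h (X id \<omega>)"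
      using h_bounds(1)[OF sp] by (simp add: mult_right_mono flip: sum_distrib_right)
  qed
  finally have le: "(\<integral>\<omega>. ev (X id \<omega>) i * h (X id \<omega>) \<partial>M) \<le> (\<integral>\<omega>. h (X id \<omega>) \<partial>M)"
    using i by simp
  have e_eq: "conformal_e_value f Z \<omega> l = ev (X id \<omega>) l" if "l \<le> n" for \<omega> l
    unfolding conformal_e_value_def ev_def X_def using that
    by (intro arg_cong[of _ _ f] map_cong) auto
  have h_eq: "g (map (conformal_e_value f Z \<omega>) [Suc i..<Suc n]) = h (X id \<omega>)" for \<omega>
    unfolding h_def using e_eq by (intro arg_cong[of _ _ g] map_cong) auto
  show ?int ?int' ?le
    using int_T[of "i - 1"] int_h le i unfolding h_eq e_eq[OF i(2)] T_id by auto
qed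

section \<open>Exponential moments and the law of large numbers\<close>

lemma conformal_e_value_nonneg:
  assumes "conformal_e_predictor N f" "exchangeable M N Z" "\<omega> \<in> space M" "1 \<le> n"
  shows "0 \<le> conformal_e_value f Z \<omega> n"
proof -
  have "Z i \<omega> \<in> space N" if "1 \<le> i" for i
    using assms that by (auto simp: exchangeable_def dest: measurable_space)
  then have "map (\<lambda>i. Z i \<omega>) [1..<Suc n] \<in> space (nonempty_seqs N)"
    using assms by (auto simp: space_nonempty_seqs)
  then show ?thesis
    unfolding conformal_e_value_def by (rule conformal_e_predictor_nonneg[OF assms(1)])
qed

lemma measurable_conformal_e_value:
  assumes f: "conformal_e_predictor N f" and Z: "exchangeable M N Z" and "1 \<le> n"
  shows "(\<lambda>\<omega>. conformal_e_value f Z \<omega> n) \<in> borel_measurable M"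
proof -
  have X: "(\<lambda>\<omega>. \<lambda>j\<in>{1..n}. Z j \<omega>) \<in> M \<rightarrow>\<^sub>M (\<Pi>\<^sub>M j\<in>{1..n}. N)"
    using Z by (intro measurable_restrict) (auto simp: exchangeable_def)
  have "(\<lambda>\<omega>. f (map (\<lambda>j\<in>{1..n}. Z j \<omega>) [1..<Suc n])) \<in> borel_measurable M"
    using \<open>1 \<le> n\<close>
    by (intro measurable_compose[OF X] measurable_compose[OF measurable_map_upt_nonempty_seqs
          conformal_e_predictor_measurable[OF f]]) auto
  moreover have "map (\<lambda>j\<in>{1..n}. Z j \<omega>) [1..<Suc n] = map (\<lambda>i. Z i \<omega>) [1..<Suc n]" for \<omega>
    by (rule map_cong) auto
  ultimately show ?thesis by (simp only: conformal_e_value_def)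
qed

text \<open>Induction on the start index downwards from \<open>n\<close>, integrating
  \<open>exp_alarms_Cons_le\<close>. The linear term contributes nothing positive by
  \<open>integral_e_value_mult_le\<close>, so each step costs only the factor from the quadratic
  term.\<close>

lemma integral_exp_alarms_le:
  assumes f: "conformal_e_predictor N f" and M: "prob_space M" and Z: "exchangeable M N Z"
    and c: "0 \<le> c" and s: "0 \<le> s" "s * (c + 1) \<le> 1" and "i \<le> n"
  shows "integrable M (\<lambda>\<omega>. exp_alarms c s (map (conformal_e_value f Z \<omega>) [Suc i..<Suc n]))
    \<and> (\<integral>\<omega>. exp_alarms c s (map (conformal_e_value f Z \<omega>) [Suc i..<Suc n]) \<partial>M)
      \<le> (1 + (s * (c + 1))\<^sup>2) ^ (n - i)"
  using \<open>i \<le> n\<close>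
proof (induction i rule: inc_induct)
  case base
  interpret prob_space M by (rule M)
  show ?case by (simp add: exp_alarms_def prob_space)
next
  case (step i)
  interpret prob_space M by (rule M)
  let ?E = "conformal_e_value f Z"
  define q where "q = 1 + (s * (c + 1))\<^sup>2"
  define W where "W \<omega> = exp_alarms c s (map (?E \<omega>) [Suc (Suc i)..<Suc n])" for \<omega>
  \<comment> \<open>The weight of \<open>x - 1\<close> in the one-step bound: a function of the
    later e-values alone, with values in \<open>[0, C]\<close> on the relevant lists.\<close>
  define g where "g xs = (1 + reverse_sr c xs) * exp_alarms c s xs" for xs
  define Y where "Y \<omega> = g (map (?E \<omega>) [Suc (Suc i)..<Suc n])" for \<omega>
  have IH: "integrable M W" "(\<integral>\<omega>. W \<omega> \<partial>M) \<le> q ^ (n - Suc i)"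
    using step unfolding W_def q_def by auto
  have ev: "(\<lambda>z. f (map z [1..<Suc l])) \<in> borel_measurable (\<Pi>\<^sub>M j\<in>{1..n}. N)"
    if "l \<in> set [Suc (Suc i)..<Suc n]" for l
    using that by (intro measurable_compose[OF measurable_map_upt_nonempty_seqs
          conformal_e_predictor_measurable[OF f]]) auto
  have meas: "(\<lambda>z. g (map (\<lambda>l. f (map z [1..<Suc l])) [Suc (Suc i)..<Suc n]))
      \<in> borel_measurable (\<Pi>\<^sub>M j\<in>{1..n}. N)"
    unfolding g_def using ev
    by (intro borel_measurable_times borel_measurable_add borel_measurable_const
        measurable_reverse_sr measurable_exp_alarms)
  define C where "C = (1 + c) * exp (s * (c * real (n - Suc i) + c))"
  have bound: "0 \<le> g xs \<and> g xs \<le> C" if "\<forall>x\<in>set xs. 0 \<le> x" "length xs = n - Suc i" for xs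
    using reverse_sr_nonneg[OF that(1)] reverse_sr_le[OF c, of xs]
      exp_alarms_le[OF c s(1), of xs] c that(2)
    unfolding g_def C_def by (auto simp: exp_alarms_def intro!: mult_mono)
  have i: "1 \<le> Suc i" "Suc i \<le> n" using step by auto
  have int: "integrable M (\<lambda>\<omega>. ?E \<omega> (Suc i) * Y \<omega>)"
    unfolding Y_def by (rule integral_e_value_mult_le(1)[OF f M Z i meas]) (rule bound)
  have intY: "integrable M Y"
    unfolding Y_def by (rule integral_e_value_mult_le(2)[OF f M Z i meas]) (rule bound)
  have le: "(\<integral>\<omega>. ?E \<omega> (Suc i) * Y \<omega> \<partial>M) \<le> (\<integral>\<omega>. Y \<omega> \<partial>M)"
    unfolding Y_def by (rule integral_e_value_mult_le(3)[OF f M Z i meas]) (rule bound)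
  have upt: "[Suc i..<Suc n] = Suc i # [Suc (Suc i)..<Suc n]"
    using step by (simp add: upt_conv_Cons)
  have ineq: "exp_alarms c s (map (?E \<omega>) [Suc i..<Suc n])
      \<le> q * W \<omega> + s * (?E \<omega> (Suc i) * Y \<omega> - Y \<omega>)" if "\<omega> \<in> space M" for \<omega>
  proof -
    have "\<forall>x\<in>set (map (?E \<omega>) [Suc (Suc i)..<Suc n]). 0 \<le> x" "0 \<le> ?E \<omega> (Suc i)"
      using conformal_e_value_nonneg[OF f Z that] by auto
    from exp_alarms_Cons_le[OF c this(2) this(1) s]
    show ?thesis unfolding upt q_def W_def Y_def g_def by (simp add: algebra_simps)
  qed
  have int': "integrable M (\<lambda>\<omega>. q * W \<omega> + s * (?E \<omega> (Suc i) * Y \<omega> - Y \<omega>))"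
    using int intY IH by auto
  have int_exp: "integrable M (\<lambda>\<omega>. exp_alarms c s (map (?E \<omega>) [Suc i..<Suc n]))"
  \<comment> \<open>Since \<open>exp_alarms\<close> is non-negative, the upper bound
    \<open>ineq\<close> also dominates it in norm.\<close>
  proof (rule Bochner_Integration.integrable_bound[OF int'])
    show "(\<lambda>\<omega>. exp_alarms c s (map (?E \<omega>) [Suc i..<Suc n])) \<in> borel_measurable M"
      by (intro measurable_exp_alarms measurable_conformal_e_value[OF f Z]) auto
    show "AE \<omega> in M. norm (exp_alarms c s (map (?E \<omega>) [Suc i..<Suc n]))
        \<le> norm (q * W \<omega> + s * (?E \<omega> (Suc i) * Y \<omega> - Y \<omega>))"
    proof (rule AE_I2)
      fix \<omega> assume "\<omega> \<in> space M"
      moreover have "0 \<le> exp_alarms c s (map (?E \<omega>) [Suc i..<Suc n])"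
        by (simp add: exp_alarms_def)
      ultimately show "norm (exp_alarms c s (map (?E \<omega>) [Suc i..<Suc n]))
        \<le> norm (q * W \<omega> + s * (?E \<omega> (Suc i) * Y \<omega> - Y \<omega>))"
        using ineq[of \<omega>] unfolding real_norm_def by linarith
    qed
  qed
  have "(\<integral>\<omega>. exp_alarms c s (map (?E \<omega>) [Suc i..<Suc n]) \<partial>M)
      \<le> (\<integral>\<omega>. q * W \<omega> + s * (?E \<omega> (Suc i) * Y \<omega> - Y \<omega>) \<partial>M)"
    by (rule integral_mono[OF int_exp int' ineq])
  also have "\<dots> = q * (\<integral>\<omega>. W \<omega> \<partial>M) + s * ((\<integral>\<omega>. ?E \<omega> (Suc i) * Y \<omega> \<partial>M) - (\<integral>\<omega>. Y \<omega> \<partial>M))"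
    using int intY IH(1) by simp
  also have "\<dots> \<le> q * (\<integral>\<omega>. W \<omega> \<partial>M)"
    using le s by (simp add: mult_nonneg_nonpos)
  also have "\<dots> \<le> q * q ^ (n - Suc i)"
    using IH(2) by (intro mult_left_mono) (auto simp: q_def)
  also have "\<dots> = q ^ (n - i)"
    using step by (simp add: Suc_diff_Suc flip: power_Suc)
  finally show ?case using int_exp unfolding q_def by blast
qed

section \<open>Tail bound and almost sure conclusion\<close>

text \<open>Chernoff bound: Markov's inequality for \<open>exp_alarms\<close> combined with its
  moment bound and \<open>1 + x \<le> exp x\<close>.\<close>

lemma reverse_alarms_tail:
  assumes f: "conformal_e_predictor N f" and M: "prob_space M" and Z: "exchangeable M N Z"
    and c: "0 \<le> c" and \<epsilon>: "0 < \<epsilon>" "\<epsilon> \<le> 1"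
  shows "measure M {\<omega>\<in>space M. (1 + \<epsilon>) * real n
        \<le> c * real (reverse_alarms c (map (conformal_e_value f Z \<omega>) [1..<Suc n]))}
      \<le> exp (- (\<epsilon>\<^sup>2 / (4 * (c + 1)\<^sup>2))) ^ n" (is "measure M ?A \<le> _")
proof -
  interpret prob_space M by (rule M)
  let ?E = "\<lambda>\<omega>. map (conformal_e_value f Z \<omega>) [1..<Suc n]"
  define K where "K = c + 1"
  have K: "1 \<le> K" using c by (simp add: K_def)
  \<comment> \<open>This \<open>s\<close> minimises the exponent per step,
    \<open>(s * K)\<^sup>2 - s * \<epsilon>\<close>. With \<open>\<epsilon> \<le> 1 \<le> K\<close>
    it also satisfies the smallness condition on \<open>s * K\<close>.\<close>
  define s where "s = \<epsilon> / (2 * K\<^sup>2)"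
  have s: "0 < s" using \<epsilon> K by (simp add: s_def)
  have sK: "s * K = \<epsilon> / (2 * K)"
    using K by (simp add: s_def power2_eq_square field_simps)
  also have "\<dots> \<le> 1" using \<epsilon> K by (simp add: field_simps)
  finally have sK1: "s * (c + 1) \<le> 1" by (simp only: K_def)
  have int: "integrable M (\<lambda>\<omega>. exp_alarms c s (?E \<omega>))"
    and le: "(\<integral>\<omega>. exp_alarms c s (?E \<omega>) \<partial>M) \<le> (1 + (s * K)\<^sup>2) ^ n"
    using integral_exp_alarms_le[OF f M Z c _ sK1, of 0 n] s unfolding K_def by (auto simp del: upt_Suc)
  have "?A \<subseteq> {\<omega>\<in>space M. exp (s * (\<epsilon> * n)) \<le> exp_alarms c s (?E \<omega>)}"
  proof safe
    fix \<omega> assume \<omega>: "\<omega> \<in> space M" and "(1 + \<epsilon>) * real n \<le> c * real (reverse_alarms c (?E \<omega>))"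
    moreover have "0 \<le> reverse_sr c (?E \<omega>)"
      by (rule reverse_sr_nonneg) (use conformal_e_value_nonneg[OF f Z \<omega>] in auto)
    ultimately have "\<epsilon> * n \<le> c * real (reverse_alarms c (?E \<omega>)) + reverse_sr c (?E \<omega>)
        - real (length (?E \<omega>))"
      by (simp add: algebra_simps del: upt_Suc)
    then show "exp (s * (\<epsilon> * n)) \<le> exp_alarms c s (?E \<omega>)"
      unfolding exp_alarms_def using s by simp
  qed
  moreover have "(\<lambda>\<omega>. exp_alarms c s (?E \<omega>)) \<in> borel_measurable M"
    using int by (rule borel_measurable_integrable)
  ultimately have "measure M ?A \<le> measure M {\<omega>\<in>space M. exp (s * (\<epsilon> * n)) \<le> exp_alarms c s (?E \<omega>)}"
    by (intro finite_measure_mono) auto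
  also have "\<dots> \<le> (\<integral>\<omega>. exp_alarms c s (?E \<omega>) \<partial>M) / exp (s * (\<epsilon> * n))"
    by (rule integral_Markov_inequality_measure[OF int sets.empty_sets])
      (auto simp: exp_alarms_def)
  also have "\<dots> \<le> (1 + (s * K)\<^sup>2) ^ n / exp (s * (\<epsilon> * n))"
    using le by (intro divide_right_mono) auto
  also have "\<dots> \<le> exp ((s * K)\<^sup>2) ^ n / exp (s * (\<epsilon> * n))"
    by (intro divide_right_mono power_mono exp_ge_add_one_self) auto
  also have "\<dots> = exp ((s * K)\<^sup>2 - s * \<epsilon>) ^ n"
    by (simp only: exp_of_nat_mult[symmetric] exp_diff[symmetric]) (simp add: algebra_simps)
  also have "(s * K)\<^sup>2 - s * \<epsilon> = - (\<epsilon>\<^sup>2 / (4 * K\<^sup>2))"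
    using K unfolding sK by (simp add: s_def power2_eq_square field_simps)
  finally show ?thesis unfolding K_def .
qed

text \<open>The tail probabilities are dominated by a convergent geometric series, so
  Borel--Cantelli applies. No relation between the backward recursions for different
  \<open>n\<close> enters.\<close>

lemma AE_eventually_reverse_alarms_less:
  assumes f: "conformal_e_predictor N f" and M: "prob_space M" and Z: "exchangeable M N Z"
    and c: "0 \<le> c" and \<epsilon>: "0 < \<epsilon>" "\<epsilon> \<le> 1"
  shows "AE \<omega> in M. eventually (\<lambda>n.
      c * real (reverse_alarms c (map (conformal_e_value f Z \<omega>) [1..<Suc n])) < (1 + \<epsilon>) * real n)
    sequentially"
proof -
  interpret prob_space M by (rule M)
  define A where "A n = {\<omega>\<in>space M. (1 + \<epsilon>) * real n
    \<le> c * real (reverse_alarms c (map (conformal_e_value f Z \<omega>) [1..<Suc n]))}" for n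
  have [measurable]: "(\<lambda>\<omega>. reverse_alarms c (map (conformal_e_value f Z \<omega>) [1..<Suc n]))
      \<in> M \<rightarrow>\<^sub>M count_space UNIV" for n
    by (intro measurable_reverse_alarms measurable_conformal_e_value[OF f Z]) auto
  have A: "A n \<in> sets M" for n
    unfolding A_def by measurable
  have "\<epsilon>\<^sup>2 / (4 * (c + 1)\<^sup>2) > 0" using \<epsilon> c by simp
  then have "summable (\<lambda>n. exp (- (\<epsilon>\<^sup>2 / (4 * (c + 1)\<^sup>2))) ^ n)"
    by (intro summable_geometric) auto
  then have "summable (\<lambda>n. measure M (A n))"
    by (rule summable_comparison_test'[where N = 0])
      (use reverse_alarms_tail[OF f M Z c \<epsilon>] in \<open>auto simp: A_def\<close>)
  then have "AE \<omega> in M. eventually (\<lambda>n. \<omega> \<in> space M - A n) sequentially"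
    using A by (intro borel_cantelli_AE1) (auto simp: less_top[symmetric])
  then show ?thesis
    by (rule AE_mp) (auto simp: A_def not_le elim!: eventually_mono)
qed

theorem proposition6:
  fixes N :: "'z measure" and M :: "'w measure"
    and f :: "'z list \<Rightarrow> real" and Z :: "nat \<Rightarrow> 'w \<Rightarrow> 'z" and c :: real
  assumes "space N \<noteq> {}"
    and "conformal_e_predictor N f"
    and "prob_space M"
    and "exchangeable M N Z"
    and "c > 1"
  shows "AE \<omega> in M.
           limsup (\<lambda>n. ereal (real (num_alarms c (conformal_e_value f Z \<omega>) n) / real n))
             \<le> ereal (1 / c)"
proof -
  note f = assms(2) and M = assms(3) and Z = assms(4)
  \<comment> \<open>Countably many values \<open>\<epsilon> = 1 / Suc k\<close> allow one null set
    to serve for all of them; \<open>k \<rightarrow> \<infinity>\<close> is taken pathwise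
    afterwards.\<close>
  have "AE \<omega> in M. \<forall>k. eventually (\<lambda>n.
      c * real (reverse_alarms c (map (conformal_e_value f Z \<omega>) [1..<Suc n]))
        < (1 + 1 / real (Suc k)) * real n) sequentially"
    unfolding AE_all_countable
    using \<open>c > 1\<close> by (intro allI AE_eventually_reverse_alarms_less[OF f M Z]) auto
  then show ?thesis
  proof (rule AE_mp, intro AE_I2 impI)
    fix \<omega> assume \<omega>: "\<omega> \<in> space M"
      and ev: "\<forall>k. eventually (\<lambda>n.
        c * real (reverse_alarms c (map (conformal_e_value f Z \<omega>) [1..<Suc n]))
          < (1 + 1 / real (Suc k)) * real n) sequentially"
    let ?a = "\<lambda>n. num_alarms c (conformal_e_value f Z \<omega>) n"
    let ?L = "limsup (\<lambda>n. ereal (real (?a n) / real n))"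
    have "?L \<le> ereal ((1 + 1 / real (Suc k)) / c)" for k
    proof (rule Limsup_bounded)
      define q where "q = 1 + 1 / real (Suc k)"
      show "eventually (\<lambda>n. ereal (real (?a n) / real n) \<le> ereal ((1 + 1 / real (Suc k)) / c))
          sequentially"
        using spec[OF ev, of k] eventually_gt_at_top[of 0] unfolding q_def[symmetric]
      proof eventually_elim
        case (elim n)
        have "c * real (?a n)
            \<le> c * real (reverse_alarms c (map (conformal_e_value f Z \<omega>) [1..<Suc n]))"
          using num_alarms_le_reverse_alarms[where c = c and n = n, OF conformal_e_value_nonneg[OF f Z \<omega>]] \<open>c > 1\<close>
          by (intro mult_left_mono) auto
        also have "\<dots> \<le> q * real n" using elim(1) by (rule less_imp_le)
        finally show ?case using elim(2) \<open>c > 1\<close>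
          by (simp add: pos_divide_le_eq pos_le_divide_eq mult.commute)
      qed
    qed
    moreover have "(\<lambda>k. ereal ((1 + 1 / real (Suc k)) / c)) \<longlonglongrightarrow> ereal ((1 + 0) / c)"
      using \<open>c > 1\<close> by (intro tendsto_intros LIMSEQ_inverse_real_of_nat[unfolded inverse_eq_divide]) auto
    ultimately show "?L \<le> ereal (1 / c)"
      by (intro LIMSEQ_le_const[where X = "\<lambda>k. ereal ((1 + 1 / real (Suc k)) / c)"]) auto
  qed
qed

end
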